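(* Let $G$ be the path on vertices $1,\dots,n$ with $n>3$, let $q=4$, and let $\Omega^+=\{0,1,2,3\}^n$ be the set of all (proper and improper) $4$-colorings of $G$. Let $\mathcal{M}_{\rightarrow}$ be the systematic scan on the state space $\Omega^+$. Then for all $\varepsilon\in(0,1)$, $$\mathrm{Mix}(\mathcal{M}_{\rightarrow},\varepsilon)\ \le\ 192\log(n\varepsilon^{-1}).$$
   Context: The $n$-vertex path has vertices $1,\dots,n$ and edges $\{i,i+1\}$. A $q$-coloring is a vector $\sigma=(\sigma_1,\dots,\sigma_n)\in\{0,\dots,q-1\}^n$; it is proper if adjacent vertices receive different colors. The procedure Metropolis($v$), applied to any coloring in $\Omega^+$: choose a color $c\in\{0,\dots,q-1\}$ uniformly at random and propose recoloring $v$ with $c$; the proposal is accepted if and only if $c$ is not used at any neighbor of $v$ (otherwise the coloring is unchanged). One step of the Markov chain $\mathcal{M}_{\rightarrow}$ (systematic scan): for $v=1,2,\dots,n$ in this order, do Metropolis($v$) (with independent color choices). The chain never moves from a proper coloring to an improper one; its stationary distribution is uniform on the set $\Omega$ of proper colorings and gives measure zero to $\Omega^+\setminus\Omega$. For a Markov chain $\mathcal{M}$ with transition matrix $P$ and stationary distribution $\pi$, $\mathrm{Mix}_x(\mathcal{M},\varepsilon)=\min\{t>0:\mathrm{d_{TV}}(P^t(x,\cdot),\pi(\cdot))\le\varepsilon\}$ and $\mathrm{Mix}(\mathcal{M},\varepsilon)=\max_x\mathrm{Mix}_x(\mathcal{M},\varepsilon)$, the maximum being over all initial states $x$ in the state space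 $\Omega^+$, where $\mathrm{d_{TV}}(\theta_1,\theta_2)=\frac12\sum_i|\theta_1(i)-\theta_2(i)|$. The logarithm is natural. *)

theory Defs
  imports "HOL-Probability.Probability"
begin

text \<open>
  A Markov chain on a finite state space \<open>S\<close> is given by a transition kernel
  \<open>K\<close>, with matrix entries \<open>P(x,y) = pmf (K x) y\<close>.
\<close>

primrec kernel_power :: "('a \<Rightarrow> 'a pmf) \<Rightarrow> nat \<Rightarrow> 'a \<Rightarrow> 'a pmf" where
  "kernel_power K 0 x = return_pmf x"
| "kernel_power K (Suc t) x = bind_pmf (kernel_power K t x) K"

definition stationary :: "('a \<Rightarrow> 'a pmf) \<Rightarrow> 'a pmf \<Rightarrow> bool" where
  "stationary K \<pi> \<longleftrightarrow> bind_pmf \<pi> K = \<pi>"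

text \<open>Meaningful only for finite \<open>S\<close> (the sum is \<open>0\<close> otherwise) containing both supports.\<close>

definition tv_dist :: "'a set \<Rightarrow> 'a pmf \<Rightarrow> 'a pmf \<Rightarrow> real" where
  "tv_dist S p r = (\<Sum>x\<in>S. \<bar>pmf p x - pmf r x\<bar>) / 2"

text \<open>
  Mixing times are extended naturals: if no \<open>t\<close> is large enough, the infimum is \<open>\<infinity>\<close>;
  otherwise it is attained and hence the minimum.
\<close>

definition mix_time_from ::
    "'a set \<Rightarrow> ('a \<Rightarrow> 'a pmf) \<Rightarrow> 'a pmf \<Rightarrow> real \<Rightarrow> 'a \<Rightarrow> enat" where
  "mix_time_from S K \<pi> \<epsilon> x =
     (INF t\<in>{t. t > 0 \<and> tv_dist S (kernel_power K t x) \<pi> \<le> \<epsilon>}. enat t)"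

definition mix_time :: "'a set \<Rightarrow> ('a \<Rightarrow> 'a pmf) \<Rightarrow> 'a pmf \<Rightarrow> real \<Rightarrow> enat" where
  "mix_time S K \<pi> \<epsilon> = (SUP x\<in>S. mix_time_from S K \<pi> \<epsilon> x)"

definition path_adj :: "nat \<Rightarrow> nat \<Rightarrow> nat \<Rightarrow> bool" where
  "path_adj n v w \<longleftrightarrow> v \<in> {1..n} \<and> w \<in> {1..n} \<and> (w = Suc v \<or> v = Suc w)"

text \<open>Colorings are extensional, so that two of them are equal iff they agree on the vertices.\<close>

definition colorings :: "nat \<Rightarrow> nat \<Rightarrow> (nat \<Rightarrow> nat) set" where
  "colorings n q = {1..n} \<rightarrow>\<^sub>E {..<q}"

definition proper_colorings :: "nat \<Rightarrow> nat \<Rightarrow> (nat \<Rightarrow> nat) set" where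
  "proper_colorings n q =
     {\<sigma> \<in> colorings n q. \<forall>v w. path_adj n v w \<longrightarrow> \<sigma> v \<noteq> \<sigma> w}"

definition metropolis :: "nat \<Rightarrow> nat \<Rightarrow> nat \<Rightarrow> (nat \<Rightarrow> nat) \<Rightarrow> (nat \<Rightarrow> nat) pmf" where
  "metropolis n q v \<sigma> =
     map_pmf (\<lambda>c. if \<exists>w. path_adj n v w \<and> \<sigma> w = c then \<sigma> else \<sigma>(v := c))
       (pmf_of_set {..<q})"

definition scan_chain :: "nat \<Rightarrow> nat \<Rightarrow> (nat \<Rightarrow> nat) \<Rightarrow> (nat \<Rightarrow> nat) pmf" where
  "scan_chain n q \<sigma> =
     fold (\<lambda>v p. bind_pmf p (metropolis n q v)) [1..<Suc n] (return_pmf \<sigma>)"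

definition uniform_proper :: "nat \<Rightarrow> nat \<Rightarrow> (nat \<Rightarrow> nat) pmf" where
  "uniform_proper n q = pmf_of_set (proper_colorings n q)"

lemma finite_colorings: "finite (colorings n q)"
  by (simp add: colorings_def finite_PiE)

lemma finite_proper_colorings: "finite (proper_colorings n q)"
  by (rule finite_subset[OF _ finite_colorings[of n q]]) (auto simp: proper_colorings_def)

lemma proper_colorings_nonempty:
  assumes "q \<ge> 2"
  shows "proper_colorings n q \<noteq> {}"
proof -
  have "(\<lambda>i\<in>{1..n}. i mod 2) \<in> proper_colorings n q"
    using assms
    by (auto simp: proper_colorings_def colorings_def path_adj_def mod_Suc split: if_splits
        intro: less_le_trans[of _ 2])
  then show ?thesis by blast
qed

lemma metropolis_colorings:
  assumes "\<sigma> \<in> colorings n q" "v \<in> {1..n}" "q > 0"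
  shows "set_pmf (metropolis n q v \<sigma>) \<subseteq> colorings n q"
proof -
  have "{..<q} \<noteq> {}" using assms(3) by auto
  then show ?thesis using assms
    by (auto simp: metropolis_def colorings_def PiE_iff extensional_def split: if_splits)
qed

lemma metropolis_proper:
  assumes "\<sigma> \<in> proper_colorings n q" "v \<in> {1..n}" "q > 0"
  shows "set_pmf (metropolis n q v \<sigma>) \<subseteq> proper_colorings n q"
proof
  fix \<tau> assume t: "\<tau> \<in> set_pmf (metropolis n q v \<sigma>)"
  have ne: "{..<q} \<noteq> {}" using assms(3) by auto
  have s: "\<sigma> \<in> colorings n q" and p: "\<And>a b. path_adj n a b \<Longrightarrow> \<sigma> a \<noteq> \<sigma> b"
    using assms(1) by (auto simp: proper_colorings_def)
  have tc: "\<tau> \<in> colorings n q" using metropolis_colorings[OF s assms(2,3)] t by blast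
  have sym: "\<And>a b. path_adj n a b \<Longrightarrow> path_adj n b a" and irr: "\<And>a. \<not> path_adj n a a"
    by (auto simp: path_adj_def)
  from t obtain c where c: "\<tau> = (if \<exists>w. path_adj n v w \<and> \<sigma> w = c then \<sigma> else \<sigma>(v := c))"
    using ne unfolding metropolis_def set_map_pmf by blast
  show "\<tau> \<in> proper_colorings n q"
  proof (cases "\<exists>w. path_adj n v w \<and> \<sigma> w = c")
    case True
    then show ?thesis using c assms(1) by simp
  next
    case False
    then have "\<tau> = \<sigma>(v := c)" using c by (simp only: if_False)
    then have "\<tau> a \<noteq> \<tau> b" if "path_adj n a b" for a b
      using False p[OF that] sym[OF that] that irr by (metis fun_upd_apply)
    then show ?thesis using tc by (simp add: proper_colorings_def)
  qed
qed

lemma metropolis_symmetric: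
  assumes "\<sigma> \<in> proper_colorings n q" "\<tau> \<in> proper_colorings n q" "v \<in> {1..n}" "q > 0"
  shows "pmf (metropolis n q v \<sigma>) \<tau> = pmf (metropolis n q v \<tau>) \<sigma>"
proof (cases "\<sigma> = \<tau>")
  case False
  have irr: "\<And>w. path_adj n v w \<Longrightarrow> w \<noteq> v" by (auto simp: path_adj_def)
  have ne: "{..<q} \<noteq> {}" using assms(4) by auto
  have *: "pmf (metropolis n q v a) b = (if b = a(v := b v) then 1 / real q else 0)"
    if "b \<in> proper_colorings n q" "a \<noteq> b" for a b
  proof -
    let ?f = "\<lambda>c. if \<exists>w. path_adj n v w \<and> a w = c then a else a(v := c)"
    have bv: "b v < q" using that(1) assms(3)
      by (auto simp: proper_colorings_def colorings_def)
    have nb: "\<And>w. path_adj n v w \<Longrightarrow> b w \<noteq> b v"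
      using that(1) by (metis (mono_tags, lifting) mem_Collect_eq proper_colorings_def)
    have "{..<q} \<inter> ?f -` {b} = (if b = a(v := b v) then {b v} else {})"
    proof (cases "b = a(v := b v)")
      case True
      have free: "\<not> (\<exists>w. path_adj n v w \<and> a w = b v)"
        using nb irr True by (metis fun_upd_apply)
      have "?f c = b \<longleftrightarrow> c = b v" for c
        using that(2) free True by (metis fun_upd_same)
      then show ?thesis using bv True by auto
    next
      case F: False
      have "?f c \<noteq> b" for c using that(2) F by (auto simp: fun_upd_def)
      then show ?thesis using F by auto
    qed
    then have "measure (pmf_of_set {..<q}) (?f -` {b}) = (if b = a(v := b v) then 1 / real q else 0)"
      using ne by (subst measure_pmf_of_set) auto
    then show ?thesis by (simp add: metropolis_def pmf_map)
  qed
  have "\<tau> = \<sigma>(v := \<tau> v) \<longleftrightarrow> \<sigma> = \<tau>(v := \<sigma> v)"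
    by (metis fun_upd_triv fun_upd_upd)
  then show ?thesis using * [OF assms(2) False] * [OF assms(1)] False by auto
qed simp

lemma metropolis_stationary:
  assumes "v \<in> {1..n}" "q \<ge> 2"
  shows "stationary (metropolis n q v) (uniform_proper n q)"
  unfolding stationary_def
proof (rule pmf_eqI)
  fix \<tau>
  let ?O = "proper_colorings n q"
  have q: "q > 0" using assms by simp
  note fin = finite_proper_colorings[of n q] and ne = proper_colorings_nonempty[OF assms(2), of n]
  have eq: "pmf (bind_pmf (uniform_proper n q) (metropolis n q v)) \<tau>
      = (\<Sum>\<sigma>\<in>?O. pmf (metropolis n q v \<sigma>) \<tau>) / card ?O"
    unfolding pmf_bind uniform_proper_def using fin ne by (simp add: integral_pmf_of_set)
  show "pmf (bind_pmf (uniform_proper n q) (metropolis n q v)) \<tau> = pmf (uniform_proper n q) \<tau>"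
  proof (cases "\<tau> \<in> ?O")
    case True
    have "(\<Sum>\<sigma>\<in>?O. pmf (metropolis n q v \<sigma>) \<tau>) = (\<Sum>\<sigma>\<in>?O. pmf (metropolis n q v \<tau>) \<sigma>)"
      using True assms(1) q by (intro sum.cong refl metropolis_symmetric)
    also have "\<dots> = 1"
      using metropolis_proper[OF True assms(1) q] fin by (rule sum_pmf_eq_1[rotated])
    finally show ?thesis
      using eq True fin ne by (simp add: uniform_proper_def)
  next
    case False
    then have "pmf (metropolis n q v \<sigma>) \<tau> = 0" if "\<sigma> \<in> ?O" for \<sigma>
      using metropolis_proper[OF that assms(1) q] by (auto simp: set_pmf_iff)
    then show ?thesis
      using eq False fin ne by (simp add: uniform_proper_def)
  qed
qed

lemma scan_chain_colorings:
  assumes "\<sigma> \<in> colorings n q" "q > 0"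
  shows "set_pmf (scan_chain n q \<sigma>) \<subseteq> colorings n q"
proof -
  have "set_pmf (fold (\<lambda>v p. bind_pmf p (metropolis n q v)) vs p) \<subseteq> colorings n q"
    if "set vs \<subseteq> {1..n}" "set_pmf p \<subseteq> colorings n q" for vs p
    using that
  proof (induction vs arbitrary: p)
    case (Cons v vs)
    have "set_pmf (bind_pmf p (metropolis n q v)) \<subseteq> colorings n q"
      using Cons.prems metropolis_colorings[of _ n q v] assms(2) by fastforce
    then show ?case using Cons by simp
  qed simp
  from this[of "[1..<Suc n]" "return_pmf \<sigma>"] assms(1) show ?thesis
    unfolding scan_chain_def by fastforce
qed

lemma scan_chain_stationary:
  assumes "q \<ge> 2"
  shows "stationary (scan_chain n q) (uniform_proper n q)"
proof -
  let ?F = "\<lambda>v p. bind_pmf p (metropolis n q v)"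
  have lin: "bind_pmf \<mu> (\<lambda>\<sigma>. fold ?F vs (k \<sigma>)) = fold ?F vs (bind_pmf \<mu> k)"
    for \<mu> :: "(nat \<Rightarrow> nat) pmf" and vs and k :: "(nat \<Rightarrow> nat) \<Rightarrow> (nat \<Rightarrow> nat) pmf"
    by (induction vs arbitrary: k) (simp_all add: bind_assoc_pmf)
  have fix_pi: "fold ?F vs (uniform_proper n q) = uniform_proper n q"
    if "set vs \<subseteq> {1..n}" for vs
    using that
  proof (induction vs)
    case (Cons v vs)
    then show ?case
      using metropolis_stationary[of v n q] assms by (simp add: stationary_def)
  qed simp
  have "set [1..<Suc n] \<subseteq> {1..n}" by auto
  then show ?thesis
    unfolding stationary_def scan_chain_def
    using fix_pi[of "[1..<Suc n]"] by (simp only: lin bind_return_pmf')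
qed

end

theory Submission
  imports Defs
begin

text \<open>
  The proof is path coupling, read backwards. One scan acts on a function \<open>g\<close> of the coloring by
  \<open>g \<mapsto> \<lambda>\<sigma>. E[g(X)]\<close>, where \<open>X\<close> is the result of scanning \<open>\<sigma>\<close>. If this action multiplies the
  Lipschitz constant of \<open>g\<close> (for Hamming distance) by at most \<open>47/48\<close>, then after \<open>t\<close> scans a
  function of oscillation \<open>1\<close> depends on the start by at most \<open>n (47/48)^t\<close>. Testing with the
  function that attains total variation distance bounds the distance to stationarity by the
  same number, and \<open>t = \<lfloor>192 ln (n/\<epsilon>)\<rfloor>\<close> makes it at most \<open>\<epsilon>\<close>. The dual reading
  spares the composition of couplings along paths and over time: only pairs that differ at one
  vertex \<open>i\<close> have to be compared, and every coupling is a permutation of the four proposals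
  (\<open>update_diff_le\<close>).

  A vertex with exactly one disagreeing neighbor, with colors \<open>p\<close> and \<open>r\<close> there, is
  coupled by letting the second copy propose with \<open>p\<close> and \<open>r\<close> exchanged. The proposal
  \<open>p\<close> is then rejected in both copies, and the only harmful proposal is \<open>r\<close>.
  To the right of \<open>i\<close> each disagreement therefore passes on with probability at
  most \<open>1/4\<close>, so a disagreement that survives at \<open>i\<close> is worth
  \<open>1 + 1/4 + 1/16 + \<dots> = 4/3\<close> (\<open>disagreement_tail\<close>). The vertex \<open>i - 1\<close> becomes bad with
  probability \<open>1/4\<close>; the one at \<open>i\<close> survives with probability at most \<open>1/2\<close>, or \<open>3/4\<close> if
  \<open>i - 1\<close> is bad. This adds up to \<open>1/4 (1 + 3/4 \<cdot> 4/3) + 3/4 \<cdot> (1/2 \<cdot> 4/3) = 1\<close>, which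
  just fails to contract.

  The missing gain comes from the colors around \<open>i\<close>. If the colors at \<open>i - 2\<close> and \<open>i + 1\<close> differ
  when \<open>i - 1\<close> is updated, then the total drops to \<open>11/12\<close> (\<open>left_neighbor_update\<close>): with
  probability \<open>1/4\<close> the colors that block \<open>i\<close> coincide in part, which makes its
  disagreement easier to remove. And the scan has just updated \<open>i - 2\<close>: whatever the
  configuration, at least one of the four proposals is accepted there and differs from
  the color at \<open>i + 1\<close> (\<open>second_left_neighbor_update\<close>). The average is at most
  \<open>3/4 + 1/4 \<cdot> 11/12 = 47/48\<close>.
\<close>

section \<open>Updates as averages over the proposed color\<close>

definition recolor :: "nat \<Rightarrow> nat \<Rightarrow> nat \<Rightarrow> (nat \<Rightarrow> nat) \<Rightarrow> nat \<Rightarrow> nat" where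
  "recolor n v c \<sigma> = (if \<exists>w. path_adj n v w \<and> \<sigma> w = c then \<sigma> else \<sigma>(v := c))"

definition update :: "nat \<Rightarrow> nat \<Rightarrow> ((nat \<Rightarrow> nat) \<Rightarrow> real) \<Rightarrow> (nat \<Rightarrow> nat) \<Rightarrow> real" where
  "update n v g \<sigma> = (\<Sum>c<4. g (recolor n v c \<sigma>)) / 4"

text \<open>
  The function acquires its updates from the inside out: the head of the list is the
  vertex that the chain updates first.
\<close>

primrec sweep :: "nat \<Rightarrow> nat list \<Rightarrow> ((nat \<Rightarrow> nat) \<Rightarrow> real) \<Rightarrow> (nat \<Rightarrow> nat) \<Rightarrow> real" where
  "sweep n [] g = g"
| "sweep n (v # vs) g = update n v (sweep n vs g)"

definition sweep_from :: "nat \<Rightarrow> nat \<Rightarrow> ((nat \<Rightarrow> nat) \<Rightarrow> real) \<Rightarrow> (nat \<Rightarrow> nat) \<Rightarrow> real" where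
  "sweep_from n v g = sweep n [v..<Suc n] g"

lemma sweep_from_step: "v \<le> n \<Longrightarrow> sweep_from n v g = update n v (sweep_from n (Suc v) g)"
  by (simp add: sweep_from_def[abs_def] upt_conv_Cons del: upt_Suc)

lemma sweep_from_end: "sweep_from n (Suc n) g = g"
  by (simp add: sweep_from_def[abs_def])

lemma path_adj_cases:
  assumes "path_adj n v w" shows "w = v - 1 \<and> 1 < v \<or> w = Suc v \<and> v < n"
  using assms by (auto simp: path_adj_def)

lemma coloring_less: "\<sigma> \<in> colorings n 4 \<Longrightarrow> w \<in> {1..n} \<Longrightarrow> \<sigma> w < 4"
  by (auto simp: colorings_def)

lemma recolor_coloring:
  assumes "\<sigma> \<in> colorings n 4" "v \<in> {1..n}" "c < 4"
  shows "recolor n v c \<sigma> \<in> colorings n 4"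
  using assms by (auto simp: recolor_def colorings_def PiE_iff extensional_def)

text \<open>
  At the ends of the path one of the two colors belongs to no vertex; demanding that \<open>c\<close> avoid
  it anyway does no harm when only the existence of a free color matters.
\<close>

lemma recolor_free:
  assumes "c \<noteq> \<sigma> (v - 1)" "c \<noteq> \<sigma> (Suc v)"
  shows "recolor n v c \<sigma> = \<sigma>(v := c)"
proof -
  have "\<not> (\<exists>w. path_adj n v w \<and> \<sigma> w = c)"
    using assms path_adj_cases by blast
  then show ?thesis by (simp only: recolor_def if_False)
qed

lemma recolor_other: "w \<noteq> v \<Longrightarrow> recolor n v c \<sigma> w = \<sigma> w"
  by (simp add: recolor_def)

text \<open>
  The proposal of the second copy is uniform whatever permutation is applied to it, so the two
  averages may be compared term by term after exchanging two colors.
\<close>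

lemma update_diff_le:
  assumes "p < 4" "r < 4"
    and "\<And>c. c < 4 \<Longrightarrow> \<bar>g (recolor n v c \<sigma>) - g (recolor n v (Transposition.transpose p r c) \<tau>)\<bar> \<le> b c"
  shows "\<bar>update n v g \<sigma> - update n v g \<tau>\<bar> \<le> (\<Sum>c<4. b c) / 4"
proof -
  have bij: "bij_betw (Transposition.transpose p r) {..<4} {..<4::nat}"
    using assms(1,2) by (intro bij_betw_transpose_iff) auto
  have "(\<Sum>c<4. g (recolor n v c \<tau>)) = (\<Sum>c<4. g (recolor n v (Transposition.transpose p r c) \<tau>))"
    using sum.reindex_bij_betw[OF bij, of "\<lambda>c. g (recolor n v c \<tau>)"] by simp
  then have "update n v g \<sigma> - update n v g \<tau> =
      (\<Sum>c<4. g (recolor n v c \<sigma>) - g (recolor n v (Transposition.transpose p r c) \<tau>)) / 4"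
    by (simp add: update_def sum_subtractf diff_divide_distrib)
  moreover have "\<bar>\<Sum>c<4. g (recolor n v c \<sigma>) - g (recolor n v (Transposition.transpose p r c) \<tau>)\<bar> \<le> (\<Sum>c<4. b c)"
    by (rule order_trans[OF sum_abs]) (use assms(3) in \<open>auto intro!: sum_mono\<close>)
  ultimately show ?thesis by linarith
qed

lemma sum_colors_le:
  fixes x y :: real
  assumes "finite E" "card E \<le> m" "x \<le> y"
  shows "(\<Sum>c<(4::nat). if c \<in> E then y else x) \<le> real m * y + (4 - real m) * x"
proof -
  have "(\<Sum>c<(4::nat). if c \<in> E then y else x)
      = (\<Sum>c<(4::nat). x + (if c \<in> E then y - x else 0))"
    by (intro sum.cong) auto
  also have "\<dots> = 4 * x + (\<Sum>c<(4::nat). if c \<in> E then y - x else 0)"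
    by (simp add: sum.distrib)
  also have "(\<Sum>c<(4::nat). if c \<in> E then y - x else 0) = real (card ({..<4} \<inter> E)) * (y - x)"
    by (simp add: sum.inter_restrict[symmetric])
  also have "\<dots> \<le> real m * (y - x)"
    using assms card_mono[of E "{..<4} \<inter> E"] by (intro mult_right_mono) auto
  finally show ?thesis by (simp add: algebra_simps)
qed

section \<open>Coupled proposals\<close>

text \<open>
  \<open>D\<close> only has to contain the disagreements. Bounds that are monotone in \<open>D\<close> then hold without
  asking whether a bad proposal really creates a disagreement.
\<close>

definition agree_off :: "nat set \<Rightarrow> (nat \<Rightarrow> nat) \<Rightarrow> (nat \<Rightarrow> nat) \<Rightarrow> bool" where
  "agree_off D \<sigma> \<tau> \<longleftrightarrow> (\<forall>w. w \<notin> D \<longrightarrow> \<sigma> w = \<tau> w)"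

text \<open>
  The situation in which exchanging \<open>p\<close> and \<open>r\<close> is a good coupling. The existence clause
  guarantees that \<open>p\<close> is blocked in the first copy and \<open>r\<close> in the second; the case \<open>p = r\<close>
  covers neighborhoods without disagreement.
\<close>

definition nbrs_swapped ::
    "nat \<Rightarrow> nat \<Rightarrow> nat \<Rightarrow> nat \<Rightarrow> (nat \<Rightarrow> nat) \<Rightarrow> (nat \<Rightarrow> nat) \<Rightarrow> bool" where
  "nbrs_swapped n v p r \<sigma> \<tau> \<longleftrightarrow>
     (\<forall>u. path_adj n v u \<longrightarrow> \<sigma> u = p \<and> \<tau> u = r \<or> \<sigma> u = \<tau> u) \<and>
     (p = r \<or> (\<exists>u. path_adj n v u \<and> \<sigma> u = p \<and> \<tau> u = r))"

lemma agree_off_recolor_any: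
  "agree_off D \<sigma> \<tau> \<Longrightarrow> agree_off (insert v D) (recolor n v c \<sigma>) (recolor n v c' \<tau>)"
  by (auto simp: agree_off_def recolor_def)

text \<open>
  Away from the proposal \<open>r\<close> nothing new goes wrong: if \<open>p\<close> is proposed, it meets a neighbor
  of its own color in both copies, and every other color is blocked in both copies or in none.
\<close>

lemma agree_off_recolor:
  assumes "agree_off D \<sigma> \<tau>" "nbrs_swapped n v p r \<sigma> \<tau>" "c \<noteq> r \<or> p = r"
  shows "agree_off D (recolor n v c \<sigma>) (recolor n v (Transposition.transpose p r c) \<tau>)"
proof (cases "c = p \<and> p \<noteq> r")
  case True
  then have "\<exists>w. path_adj n v w \<and> \<sigma> w = c" "\<exists>w. path_adj n v w \<and> \<tau> w = r"
    using assms(2) by (auto simp: nbrs_swapped_def)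
  then have "recolor n v c \<sigma> = \<sigma>" "recolor n v r \<tau> = \<tau>"
    by (simp_all only: recolor_def if_True)
  then show ?thesis
    using True assms(1) by (simp only: transpose_apply_first)
next
  case False
  then have c: "Transposition.transpose p r c = c"
    by (cases "p = r") (use False assms(3) in simp_all)
  have "(\<exists>w. path_adj n v w \<and> \<sigma> w = c) \<longleftrightarrow> (\<exists>w. path_adj n v w \<and> \<tau> w = c)"
  proof -
    have "\<sigma> w = c \<longleftrightarrow> \<tau> w = c" if "path_adj n v w" for w
      using assms(2,3) False that by (auto simp: nbrs_swapped_def)
    then show ?thesis by blast
  qed
  then have "(recolor n v c \<sigma>, recolor n v c \<tau>) \<in> {(\<sigma>, \<tau>), (\<sigma>(v := c), \<tau>(v := c))}"
    by (cases "\<exists>w. path_adj n v w \<and> \<tau> w = c")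
       (simp_all only: recolor_def if_True if_False insert_iff simp_thms)
  then show ?thesis
    using assms(1) c by (auto simp: agree_off_def)
qed

lemma agree_off_recolor_accepted:
  assumes "agree_off D \<sigma> \<tau>" "c \<noteq> p" "c \<noteq> r"
    and "\<And>u. path_adj n v u \<Longrightarrow> \<sigma> u \<noteq> c \<and> \<tau> u \<noteq> c"
  shows "agree_off (D - {v}) (recolor n v c \<sigma>) (recolor n v (Transposition.transpose p r c) \<tau>)"
proof -
  have "recolor n v c \<sigma> = \<sigma>(v := c)" "recolor n v c \<tau> = \<tau>(v := c)"
    using assms(4) by (auto simp: recolor_def)
  then show ?thesis
    using assms(1-3) by (auto simp: agree_off_def)
qed

lemma nbrs_swapped_same:
  "agree_off D \<sigma> \<tau> \<Longrightarrow> v - 1 \<notin> D \<Longrightarrow> Suc v \<notin> D \<Longrightarrow> nbrs_swapped n v p p \<sigma> \<tau>"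
  by (auto simp: nbrs_swapped_def agree_off_def dest: path_adj_cases)

lemma nbrs_swapped_left:
  assumes "agree_off D \<sigma> \<tau>" "Suc v \<notin> D" "1 < v" "v \<le> n"
  shows "nbrs_swapped n v (\<sigma> (v - 1)) (\<tau> (v - 1)) \<sigma> \<tau>"
proof -
  have "path_adj n v (v - 1)" using assms by (auto simp: path_adj_def)
  then show ?thesis
    using assms by (auto simp: nbrs_swapped_def agree_off_def dest: path_adj_cases)
qed

lemma nbrs_swapped_right:
  assumes "agree_off D \<sigma> \<tau>" "v - 1 \<notin> D" "1 \<le> v" "v < n"
  shows "nbrs_swapped n v (\<sigma> (Suc v)) (\<tau> (Suc v)) \<sigma> \<tau>"
proof -
  have "path_adj n v (Suc v)" using assms by (auto simp: path_adj_def)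
  then show ?thesis
    using assms by (auto simp: nbrs_swapped_def agree_off_def dest: path_adj_cases)
qed

section \<open>One disagreement through one scan\<close>

text \<open>
  Quantifying over all sets that contain the disagreements instead of counting the
  disagreements is equivalent for \<open>0 \<le> L\<close>, and matches the over-approximation in
  \<open>agree_off\<close>.
\<close>

definition hamming_lipschitz :: "nat \<Rightarrow> real \<Rightarrow> ((nat \<Rightarrow> nat) \<Rightarrow> real) \<Rightarrow> bool" where
  "hamming_lipschitz n L g \<longleftrightarrow>
     (\<forall>D \<sigma> \<tau>. D \<subseteq> {1..n} \<longrightarrow> \<sigma> \<in> colorings n 4 \<longrightarrow> \<tau> \<in> colorings n 4 \<longrightarrow>
        agree_off D \<sigma> \<tau> \<longrightarrow> \<bar>g \<sigma> - g \<tau>\<bar> \<le> L * real (card D))"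

context
  fixes n :: nat and L :: real and g :: "(nat \<Rightarrow> nat) \<Rightarrow> real"
  assumes lip: "hamming_lipschitz n L g" and L: "0 \<le> L"
begin

text \<open>
  Behind the position \<open>v\<close> of the scan nothing changes any more, so disagreements there count
  fully. Only one at \<open>v - 1\<close> can spread, with probability \<open>1/4\<close> per step, and \<open>1/3\<close> is the sum of
  the geometric series \<open>1/4 + 1/16 + \<dots>\<close>: it solves \<open>x = 1/4 (1 + x)\<close>.
\<close>

lemma disagreement_tail:
  assumes "v \<le> Suc n" "1 \<le> v" "D \<subseteq> {1..<v}" "\<sigma> \<in> colorings n 4" "\<tau> \<in> colorings n 4"
    "agree_off D \<sigma> \<tau>"
  shows "\<bar>sweep_from n v g \<sigma> - sweep_from n v g \<tau>\<bar>
     \<le> L * (real (card D) + (if v - 1 \<in> D then 1/3 else 0))"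
  using assms
proof (induction v arbitrary: D \<sigma> \<tau> rule: inc_induct)
  case base
  then have "D \<subseteq> {1..n}" by auto
  then have "\<bar>g \<sigma> - g \<tau>\<bar> \<le> L * real (card D)"
    using lip[unfolded hamming_lipschitz_def, rule_format, OF _ base(3,4,5)] by simp
  also have "\<dots> \<le> L * (real (card D) + (if Suc n - 1 \<in> D then 1/3 else 0))"
    using L by (intro mult_left_mono) auto
  finally show ?case by (simp only: sweep_from_end)
next
  case (step v)
  let ?g = "sweep_from n (Suc v) g"
  have v: "v \<in> {1..n}" and vn: "v \<le> n" using step.hyps step.prems(1) by auto
  have vD: "v \<notin> D" "Suc v \<notin> D" using step.prems(2) by auto
  have finD: "finite D" using step.prems(2) by (rule finite_subset) simp
  have IH: "\<bar>?g \<sigma>' - ?g \<tau>'\<bar> \<le> L * (real (card D') + (if v \<in> D' then 1/3 else 0))"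
    if "D' \<subseteq> {1..<Suc v}" "\<sigma>' \<in> colorings n 4" "\<tau>' \<in> colorings n 4" "agree_off D' \<sigma>' \<tau>'"
    for D' \<sigma>' \<tau>'
    using step.IH[of D' \<sigma>' \<tau>'] that by simp
  \<comment> \<open>The value 0 stands for any color: with \<open>p = r\<close> the exchange is the identity.\<close>
  define p where "p = (if v - 1 \<in> D then \<sigma> (v - 1) else 0)"
  define r where "r = (if v - 1 \<in> D then \<tau> (v - 1) else 0)"
  have nb: "nbrs_swapped n v p r \<sigma> \<tau>"
  proof (cases "v - 1 \<in> D")
    case True
    then have "1 < v" using step.prems(2) by force
    then show ?thesis
      using nbrs_swapped_left[OF step.prems(5) vD(2) _ vn] True by (simp add: p_def r_def)
  next
    case False
    then show ?thesis
      using nbrs_swapped_same[OF step.prems(5) False vD(2), of n 0] by (simp add: p_def r_def)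
  qed
  have pr: "p < 4" "r < 4"
      proof -
    have "v - 1 \<in> D \<Longrightarrow> v - 1 \<in> {1..n}" using step.prems(2) vn by force
    then show "p < 4" "r < 4"
      using step.prems(3,4) coloring_less[of _ n "v - 1"] by (auto simp: p_def r_def)
  qed
  let ?E = "if v - 1 \<in> D then {r} else {}"
  let ?x = "L * real (card D)" and ?y = "L * (real (card D) + 1 + 1/3)"
  have "\<bar>update n v ?g \<sigma> - update n v ?g \<tau>\<bar> \<le> (\<Sum>c<4. if c \<in> ?E then ?y else ?x) / 4"
  proof (rule update_diff_le[OF pr])
    fix c :: nat assume c: "c < 4"
    have tc: "Transposition.transpose p r c < 4" using c pr by (simp add: Transposition.transpose_def)
    have cols: "recolor n v c \<sigma> \<in> colorings n 4" "recolor n v (Transposition.transpose p r c) \<tau> \<in> colorings n 4"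
      using step.prems(3,4) v c tc by (simp_all add: recolor_coloring)
    show "\<bar>?g (recolor n v c \<sigma>) - ?g (recolor n v (Transposition.transpose p r c) \<tau>)\<bar> \<le> (if c \<in> ?E then ?y else ?x)"
    proof (cases "c \<in> ?E")
      case True
      have "insert v D \<subseteq> {1..<Suc v}" using step.prems v by auto
      from IH[OF this cols agree_off_recolor_any[OF step.prems(5)]] True vD finD
      show ?thesis by (simp add: add.commute)
    next
      case False
      then have "c \<noteq> r \<or> p = r" by (auto simp: p_def r_def split: if_splits)
      moreover have "D \<subseteq> {1..<Suc v}" using step.prems by fastforce
      ultimately show ?thesis
        using agree_off_recolor[OF step.prems(5) nb] IH[OF _ cols, of D] vD False by simp
    qed
  qed
  also have "\<dots> \<le> L * (real (card D) + (if v - 1 \<in> D then 1/3 else 0))"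
  proof (cases "v - 1 \<in> D")
    case True
    have "?x \<le> ?y" using L by (intro mult_left_mono) auto
    then have "(\<Sum>c<4. if c \<in> ?E then ?y else ?x) \<le> real 1 * ?y + (4 - real 1) * ?x"
      by (intro sum_colors_le) auto
    also have "\<dots> = 4 * (L * (real (card D) + 1/3))" by (simp add: algebra_simps)
    finally show ?thesis using True by (simp only: if_True)
  qed simp
  finally show ?case using vn by (simp only: sweep_from_step)
qed

text \<open>
  The update of \<open>i\<close> itself. A proposal outside the set \<open>E\<close> of colors seen by \<open>i\<close> in either copy is
  accepted by both copies, and what remains is the possible disagreement at \<open>i - 1\<close>, which is
  final. With the others the disagreement at \<open>i\<close> may survive and costs its tail as well. Hence
  everything depends on how few colors block \<open>i\<close>.
\<close>

lemma disagreement_removal: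
  assumes i: "1 \<le> i" "i \<le> n" and D: "D \<subseteq> {i - 1, i}" "D \<subseteq> {1..n}"
    and col: "\<sigma> \<in> colorings n 4" "\<tau> \<in> colorings n 4" and ag: "agree_off D \<sigma> \<tau>"
    and E: "finite E" "card E \<le> m"
    and blocked: "\<And>u. path_adj n i u \<Longrightarrow> \<sigma> u \<in> E \<and> \<tau> u \<in> E"
  shows "\<bar>sweep_from n i g \<sigma> - sweep_from n i g \<tau>\<bar>
     \<le> L * (real m * (real (card (insert i D)) + 1/3) + (4 - real m) * real (card (D - {i}))) / 4"
proof -
  let ?g = "sweep_from n (Suc i) g"
  have finD: "finite D" using D finite_subset by blast
  have iD: "Suc i \<notin> D" using D(1) by auto
  define p where "p = (if 1 < i then \<sigma> (i - 1) else 0)"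
  define r where "r = (if 1 < i then \<tau> (i - 1) else 0)"
  have nb: "nbrs_swapped n i p r \<sigma> \<tau>"
  proof (cases "1 < i")
    case True
    then show ?thesis
      using nbrs_swapped_left[of D \<sigma> \<tau> i n] i iD ag by (simp add: p_def r_def)
  next
    case False
    then have "i - 1 \<notin> D" using D(2) i by auto
    then show ?thesis
      using nbrs_swapped_same[OF ag _ iD, of n 0] False by (simp add: p_def r_def)
  qed
  have pr: "p < 4" "r < 4"
  proof -
    have "1 < i \<Longrightarrow> i - 1 \<in> {1..n}" using i by auto
    then show "p < 4" "r < 4"
      using col coloring_less[of _ n "i - 1"] by (auto simp: p_def r_def)
  qed
  have prE: "p \<in> E \<and> r \<in> E \<or> p = r"
  proof (cases "1 < i")
    case True
    then have "path_adj n i (i - 1)" using i by (auto simp: path_adj_def)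
    then show ?thesis using blocked[of "i - 1"] True by (simp add: p_def r_def)
  qed (simp add: p_def r_def)
  let ?x = "L * real (card (D - {i}))" and ?y = "L * (real (card (insert i D)) + 1/3)"
  have tail: "\<bar>?g \<sigma>' - ?g \<tau>'\<bar> \<le> L * (real (card D') + (if i \<in> D' then 1/3 else 0))"
    if "D' \<subseteq> insert i D" "\<sigma>' \<in> colorings n 4" "\<tau>' \<in> colorings n 4" "agree_off D' \<sigma>' \<tau>'"
    for D' \<sigma>' \<tau>'
  proof -
    have "D' \<subseteq> {1..<Suc i}" using that(1) D i by (auto simp: subset_iff less_Suc_eq_le)
    from disagreement_tail[OF _ _ this that(2-4)] i show ?thesis by simp
  qed
  have "\<bar>update n i ?g \<sigma> - update n i ?g \<tau>\<bar> \<le> (\<Sum>c<4. if c \<in> E then ?y else ?x) / 4"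
  proof (rule update_diff_le[OF pr])
    fix c :: nat assume c: "c < 4"
    have tc: "Transposition.transpose p r c < 4" using c pr by (simp add: Transposition.transpose_def)
    have cols: "recolor n i c \<sigma> \<in> colorings n 4" "recolor n i (Transposition.transpose p r c) \<tau> \<in> colorings n 4"
      using col i c tc by (simp_all add: recolor_coloring)
    show "\<bar>?g (recolor n i c \<sigma>) - ?g (recolor n i (Transposition.transpose p r c) \<tau>)\<bar> \<le> (if c \<in> E then ?y else ?x)"
    proof (cases "c \<in> E")
      case True
      from tail[OF subset_refl cols agree_off_recolor_any[OF ag]] True
      show ?thesis by simp
    next
      case False
      then have unb: "\<sigma> u \<noteq> c \<and> \<tau> u \<noteq> c" if "path_adj n i u" for u using blocked[OF that] by auto
      have "agree_off (D - {i}) (recolor n i c \<sigma>) (recolor n i (Transposition.transpose p r c) \<tau>)"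
      proof (cases "p = r")
        case True
        \<comment> \<open>The exchange is the identity, so it may be replaced by the exchange of any color
          other than \<open>c\<close> with itself.\<close>
        then show ?thesis
          using agree_off_recolor_accepted[of D \<sigma> \<tau> c "Suc c" "Suc c", OF ag _ _ unb] by simp
      next
        case pr: False
        then have "c \<noteq> p" "c \<noteq> r" using False prE by auto
        then show ?thesis by (rule agree_off_recolor_accepted[OF ag _ _ unb])
      qed
      from tail[OF _ cols this] False show ?thesis by auto
    qed
  qed
  also have "(\<Sum>c<4. if c \<in> E then ?y else ?x) \<le> real m * ?y + (4 - real m) * ?x"
  proof (rule sum_colors_le[OF E])
    have "card (D - {i}) \<le> card (insert i D)" using finD by (intro card_mono) auto
    then show "?x \<le> ?y" using L by (intro mult_left_mono) auto
  qed
  finally show ?thesis using i by (simp add: sweep_from_step algebra_simps)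
qed

text \<open>
  If the copies agree at \<open>i - 1\<close>, two colors block \<open>i\<close>, and only one color does so if
  the two neighbors have the same color or if \<open>i\<close> is the right end of the path.
\<close>

lemma single_removal:
  assumes "1 \<le> i" "i \<le> n" "\<sigma> \<in> colorings n 4" "\<tau> \<in> colorings n 4" "agree_off {i} \<sigma> \<tau>"
  shows "\<bar>sweep_from n i g \<sigma> - sweep_from n i g \<tau>\<bar> \<le> L * (2/3)"
    and "1 < i \<Longrightarrow> i = n \<or> \<sigma> (i - 1) = \<sigma> (Suc i)
      \<Longrightarrow> \<bar>sweep_from n i g \<sigma> - sweep_from n i g \<tau>\<bar> \<le> L * (1/3)"
proof -
  have ag: "\<sigma> (i - 1) = \<tau> (i - 1)" "\<sigma> (Suc i) = \<tau> (Suc i)"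
    using assms by (auto simp: agree_off_def)
  have c2: "card {\<sigma> (i - 1), \<sigma> (Suc i)} \<le> 2" by (simp add: card_insert_if)
  have u2: "\<sigma> u \<in> {\<sigma> (i - 1), \<sigma> (Suc i)} \<and> \<tau> u \<in> {\<sigma> (i - 1), \<sigma> (Suc i)}" if "path_adj n i u" for u
    using path_adj_cases[OF that] ag by auto
  have "\<bar>sweep_from n i g \<sigma> - sweep_from n i g \<tau>\<bar>
     \<le> L * (real 2 * (real (card (insert i {i})) + 1/3) + (4 - real 2) * real (card ({i} - {i}))) / 4"
    by (rule disagreement_removal[OF assms(1,2) _ _ assms(3-5) _ c2 u2]) (use assms in auto)
  then show "\<bar>sweep_from n i g \<sigma> - sweep_from n i g \<tau>\<bar> \<le> L * (2/3)" by simp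
  assume "1 < i" and 1: "i = n \<or> \<sigma> (i - 1) = \<sigma> (Suc i)"
  have u: "\<sigma> u \<in> {\<sigma> (i - 1)} \<and> \<tau> u \<in> {\<sigma> (i - 1)}" if "path_adj n i u" for u
    using path_adj_cases[OF that] 1 ag by auto
  have "\<bar>sweep_from n i g \<sigma> - sweep_from n i g \<tau>\<bar>
     \<le> L * (real 1 * (real (card (insert i {i})) + 1/3) + (4 - real 1) * real (card ({i} - {i}))) / 4"
    by (rule disagreement_removal[OF assms(1,2) _ _ assms(3-5) _ _ u]) (use assms in auto)
  then show "\<bar>sweep_from n i g \<sigma> - sweep_from n i g \<tau>\<bar> \<le> L * (1/3)" by simp
qed

text \<open>
  If the copies disagree at \<open>i - 1\<close>, three colors are blocked at \<open>i\<close> in at least one copy, unless the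
  color at \<open>i + 1\<close> is one of the two at \<open>i - 1\<close>.
\<close>

lemma double_removal:
  assumes "1 < i" "i \<le> n" "\<sigma> \<in> colorings n 4" "\<tau> \<in> colorings n 4" "agree_off {i - 1, i} \<sigma> \<tau>"
  shows "\<bar>sweep_from n i g \<sigma> - sweep_from n i g \<tau>\<bar> \<le> L * 2"
    and "\<sigma> (Suc i) \<in> {\<sigma> (i - 1), \<tau> (i - 1)}
      \<Longrightarrow> \<bar>sweep_from n i g \<sigma> - sweep_from n i g \<tau>\<bar> \<le> L * (5/3)"
proof -
  have ag: "\<sigma> (Suc i) = \<tau> (Suc i)" using assms by (auto simp: agree_off_def)
  have cards: "card (insert i {i - 1, i}) = 2" "card ({i - 1, i} - {i}) = 1"
  proof -
    have "insert i {i - 1, i} = {i - 1, i}" "{i - 1, i} - {i} = {i - 1}" "i - 1 \<noteq> i"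
      using assms(1) by auto
    then show "card (insert i {i - 1, i}) = 2" "card ({i - 1, i} - {i}) = 1" by simp_all
  qed
  have sub: "{i - 1, i} \<subseteq> {1..n}" using assms by auto
  let ?E = "{\<sigma> (i - 1), \<tau> (i - 1), \<sigma> (Suc i)}"
  have c3: "card ?E \<le> 3" by (simp add: card_insert_if)
  have u3: "\<sigma> u \<in> ?E \<and> \<tau> u \<in> ?E" if "path_adj n i u" for u
    using path_adj_cases[OF that] ag by auto
  have "\<bar>sweep_from n i g \<sigma> - sweep_from n i g \<tau>\<bar>
     \<le> L * (real 3 * (real (card (insert i {i-1,i})) + 1/3) + (4 - real 3) * real (card ({i-1,i} - {i}))) / 4"
    by (rule disagreement_removal[OF _ assms(2) _ sub assms(3-5) _ c3 u3]) (use assms in auto)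
  then show "\<bar>sweep_from n i g \<sigma> - sweep_from n i g \<tau>\<bar> \<le> L * 2" by (simp only: cards) simp
  assume 1: "\<sigma> (Suc i) \<in> {\<sigma> (i - 1), \<tau> (i - 1)}"
  have c2: "card {\<sigma> (i - 1), \<tau> (i - 1)} \<le> 2" by (simp add: card_insert_if)
  have u: "\<sigma> u \<in> {\<sigma> (i - 1), \<tau> (i - 1)} \<and> \<tau> u \<in> {\<sigma> (i - 1), \<tau> (i - 1)}" if "path_adj n i u" for u
    using path_adj_cases[OF that] 1 ag by auto
  have "\<bar>sweep_from n i g \<sigma> - sweep_from n i g \<tau>\<bar>
     \<le> L * (real 2 * (real (card (insert i {i-1,i})) + 1/3) + (4 - real 2) * real (card ({i-1,i} - {i}))) / 4"
    by (rule disagreement_removal[OF _ assms(2) _ sub assms(3-5) _ c2 u]) (use assms in auto)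
  then show "\<bar>sweep_from n i g \<sigma> - sweep_from n i g \<tau>\<bar> \<le> L * (5/3)" by (simp only: cards) simp
qed

text \<open>
  The update of \<open>i - 1\<close> just before that of \<open>i\<close>. Let \<open>a\<close> and \<open>b\<close> be the colors at \<open>i\<close>, and \<open>d\<close> the
  color at \<open>i + 1\<close>. In general, the harmful proposal \<open>b\<close> costs \<open>2\<close> and each of the three
  others \<open>2/3\<close>, which is \<open>1\<close> on average. The gain needs \<open>d\<close> to be acceptable at \<open>i - 1\<close> as far as
  \<open>i - 2\<close> is concerned. If \<open>d\<close> is \<open>a\<close> or \<open>b\<close>, the harmful proposal places \<open>d\<close> at
  \<open>i - 1\<close> in one copy and its cost falls to \<open>5/3\<close>. If \<open>d\<close> is a third color, the proposal
  \<open>d\<close> is accepted in both copies and its cost falls to \<open>1/3\<close>. At the ends of the path the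
  missing neighbor produces the gain by itself.
\<close>

lemma left_neighbor_update:
  assumes i: "1 < i" "i \<le> n" and col: "\<sigma> \<in> colorings n 4" "\<tau> \<in> colorings n 4"
    and ag: "agree_off {i} \<sigma> \<tau>"
  shows "\<bar>sweep_from n (i - 1) g \<sigma> - sweep_from n (i - 1) g \<tau>\<bar> \<le> L"
    and "2 < i \<and> i < n \<longrightarrow> \<sigma> (i - 2) \<noteq> \<sigma> (Suc i)
      \<Longrightarrow> \<bar>sweep_from n (i - 1) g \<sigma> - sweep_from n (i - 1) g \<tau>\<bar> \<le> L * (11/12)"
proof -
  define v where "v = i - 1"
  have v: "1 \<le> v" "v < n" "v \<in> {1..n}" "Suc v = i" using i by (auto simp: v_def)
  let ?g = "sweep_from n i g"
  define a where "a = \<sigma> i"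
  define b where "b = \<tau> i"
  have ab: "a < 4" "b < 4" using col i coloring_less[of _ n i] by (auto simp: a_def b_def)
  have nb: "nbrs_swapped n v a b \<sigma> \<tau>"
    using nbrs_swapped_right[OF ag, of v n] v by (auto simp: a_def b_def)
  let ?s = "\<lambda>c. recolor n v c \<sigma>" and ?t = "\<lambda>c. recolor n v (Transposition.transpose a b c) \<tau>"
  have cols: "?s c \<in> colorings n 4" "?t c \<in> colorings n 4" if "c < 4" for c
    using col v(3) that ab by (simp_all add: recolor_coloring Transposition.transpose_def)
  have ag1: "agree_off {i} (?s c) (?t c)" if "c \<noteq> b" for c
    using agree_off_recolor[OF ag nb] that by simp
  have ag2: "agree_off {i - 1, i} (?s c) (?t c)" for c
    using agree_off_recolor_any[OF ag] by (simp add: v_def)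
  have step: "sweep_from n (i - 1) g = update n v ?g"
    using sweep_from_step[of v n g] v by (simp add: v_def)
  have bd: "\<bar>?g (?s c) - ?g (?t c)\<bar> \<le> L * (if c = b then 2 else 2/3)" if "c < 4" for c
  proof (cases "c = b")
    case True
    then show ?thesis using double_removal(1)[OF i cols[OF that] ag2] by (simp only: True if_True simp_thms)
  next
    case False
    then show ?thesis using single_removal(1)[OF _ i(2) cols[OF that] ag1] i by simp
  qed
  have sum1: "(\<Sum>c<(4::nat). if c = b then y else x) = y + 3 * x" for x y :: real
  proof -
    have "(\<Sum>c<(4::nat). if c = b then y else x) = (\<Sum>c<4. x + (if c = b then y - x else 0))"
      by (intro sum.cong) auto
    then show ?thesis using ab by (simp add: sum.distrib)
  qed
  have "\<bar>update n v ?g \<sigma> - update n v ?g \<tau>\<bar> \<le> (\<Sum>c<4. L * (if c = b then 2 else 2/3)) / 4"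
    by (rule update_diff_le[OF ab bd])
  also have "\<dots> = L" by (simp add: sum_distrib_left[symmetric] sum1)
  finally show "\<bar>sweep_from n (i - 1) g \<sigma> - sweep_from n (i - 1) g \<tau>\<bar> \<le> L"
    by (simp only: step)
  assume gap: "2 < i \<and> i < n \<longrightarrow> \<sigma> (i - 2) \<noteq> \<sigma> (Suc i)"
  define d where "d = \<sigma> (Suc i)"
  have d': "\<tau> (Suc i) = d" using ag by (simp add: agree_off_def d_def)
  have nbrs: "w = i \<or> w = i - 2 \<and> 2 < i" if "path_adj n v w" for w
    using path_adj_cases[OF that] v i by (auto simp: v_def)
  have acc_s: "?s c = \<sigma>(v := c)" if "c \<noteq> a" "2 < i \<longrightarrow> c \<noteq> \<sigma> (i - 2)" for c
  proof -
    have "\<not> (\<exists>w. path_adj n v w \<and> \<sigma> w = c)"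
      using that nbrs by (auto simp: a_def)
    then show ?thesis by (simp only: recolor_def if_False)
  qed
  have acc_t: "recolor n v c \<tau> = \<tau>(v := c)" if "c \<noteq> b" "2 < i \<longrightarrow> c \<noteq> \<sigma> (i - 2)" for c
  proof -
    have "\<tau> (i - 2) = \<sigma> (i - 2)" using ag i by (simp add: agree_off_def)
    then have "\<not> (\<exists>w. path_adj n v w \<and> \<tau> w = c)"
      using that nbrs by (auto simp: b_def)
    then show ?thesis by (simp only: recolor_def if_False)
  qed
  have si: "?s c (Suc i) = d" for c
    using v by (simp add: recolor_other d_def)
  have "\<bar>update n v ?g \<sigma> - update n v ?g \<tau>\<bar> \<le> L * (11/12)"
  proof (cases "a = b")
    case True
    then have "\<sigma> w = \<tau> w" for w using ag by (cases "w = i") (auto simp: agree_off_def a_def b_def)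
    then have "\<sigma> = \<tau>" by auto
    then show ?thesis using L by simp
  next
    case ne: False
    consider "i = n" | "i < n" "d = a \<or> d = b" | "i < n" "d \<noteq> a" "d \<noteq> b" using i by linarith
    then show ?thesis
    proof cases
      case 1
      have "\<bar>?g (?s c) - ?g (?t c)\<bar> \<le> L * (if c = b then 2 else 1/3)" if "c < 4" for c
        using single_removal(2)[OF _ i(2) cols[OF that] ag1 i(1)] bd[OF that] 1 i by auto
      then have "\<bar>update n v ?g \<sigma> - update n v ?g \<tau>\<bar> \<le> (\<Sum>c<4. L * (if c = b then 2 else 1/3)) / 4"
        by (rule update_diff_le[OF ab])
      then show ?thesis using L by (simp add: sum_distrib_left[symmetric] sum1)
    next
      case 2
      have "d \<in> {?s b (i - 1), ?t b (i - 1)}"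
        using 2(2)
      proof
        assume "d = b"
        then have "?s b = \<sigma>(v := b)" using acc_s[of b] gap 2(1) ne by (auto simp: d_def)
        then show ?thesis using \<open>d = b\<close> by (simp add: v_def)
      next
        assume "d = a"
        then have "?t b = \<tau>(v := a)" using acc_t[of a] gap 2(1) ne by (auto simp: d_def)
        then show ?thesis using \<open>d = a\<close> by (simp add: v_def)
      qed
      then have "\<bar>?g (?s b) - ?g (?t b)\<bar> \<le> L * (5/3)"
        using double_removal(2)[OF i cols[OF ab(2)] ag2] si by simp
      then have "\<bar>?g (?s c) - ?g (?t c)\<bar> \<le> L * (if c = b then 5/3 else 2/3)" if "c < 4" for c
        using bd[OF that] by auto
      then have "\<bar>update n v ?g \<sigma> - update n v ?g \<tau>\<bar> \<le> (\<Sum>c<4. L * (if c = b then 5/3 else 2/3)) / 4"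
        by (rule update_diff_le[OF ab])
      then show ?thesis by (simp add: sum_distrib_left[symmetric] sum1)
    next
      case 3
      have d4: "d < 4" using col 3 coloring_less[of \<sigma> n "Suc i"] by (auto simp: d_def)
      have "?s d = \<sigma>(v := d)" using acc_s[of d] gap 3 by (auto simp: d_def)
      then have "?s d (i - 1) = d" by (simp add: v_def)
      then have "?s d (i - 1) = ?s d (Suc i)" by (simp only: si)
      then have "\<bar>?g (?s d) - ?g (?t d)\<bar> \<le> L * (1/3)"
        using single_removal(2)[OF _ i(2) cols[OF d4] ag1] 3 i by auto
      then have bd3: "\<bar>?g (?s c) - ?g (?t c)\<bar> \<le> L * (if c = b then 2 else if c = d then 1/3 else 2/3)"
        if "c < 4" for c
        using bd[OF that] 3 by (cases "c = d") auto
      have "(\<Sum>c<(4::nat). if c = b then 2 else if c = d then 1/3 else 2/3 :: real)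
          = (\<Sum>c<4. 2/3 + (if c = b then 4/3 else 0) - (if c = d then 1/3 else 0))"
        using 3 by (intro sum.cong) auto
      also have "\<dots> = 11/3" using ab d4 by (simp add: sum.distrib sum_subtractf)
      finally have "\<bar>update n v ?g \<sigma> - update n v ?g \<tau>\<bar> \<le> L * (11/3) / 4"
        using update_diff_le[OF ab bd3] by (simp only: sum_distrib_left[symmetric])
      then show ?thesis by simp
    qed
  qed
  then show "\<bar>sweep_from n (i - 1) g \<sigma> - sweep_from n (i - 1) g \<tau>\<bar> \<le> L * (11/12)"
    by (simp only: step)
qed

text \<open>
  Some color differs from both neighbors of \<open>i - 2\<close> and from the color at \<open>i + 1\<close>. With
  probability \<open>1/4\<close> it is proposed at \<open>i - 2\<close>, hence accepted, and produces the configuration in which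
  the next update gains \<open>1/12\<close>.
\<close>

lemma second_left_neighbor_update:
  assumes i: "2 < i" "i \<le> n" and col: "\<sigma> \<in> colorings n 4" "\<tau> \<in> colorings n 4"
    and ag: "agree_off {i} \<sigma> \<tau>"
  shows "\<bar>sweep_from n (i - 2) g \<sigma> - sweep_from n (i - 2) g \<tau>\<bar> \<le> L * (47/48)"
proof -
  define v where "v = i - 2"
  have v: "v \<in> {1..n}" "v \<le> n" "Suc v = i - 1" using i by (auto simp: v_def)
  let ?g = "sweep_from n (i - 1) g"
  have nb: "nbrs_swapped n v 0 0 \<sigma> \<tau>"
    using nbrs_swapped_same[OF ag] v i by auto
  have step: "sweep_from n (i - 2) g = update n v ?g"
    using sweep_from_step[OF v(2), of g] v(3) by (simp add: v_def)
  have "card {\<sigma> (v - 1), \<sigma> (Suc v), \<sigma> (Suc i)} < card {..<4::nat}"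
    by (simp add: card_insert_if)
  then have "\<not> {..<4} \<subseteq> {\<sigma> (v - 1), \<sigma> (Suc v), \<sigma> (Suc i)}"
    using card_mono[of "{\<sigma> (v - 1), \<sigma> (Suc v), \<sigma> (Suc i)}" "{..<4}"] by fastforce
  then obtain e where e: "e < 4" "e \<noteq> \<sigma> (v - 1)" "e \<noteq> \<sigma> (Suc v)" "e \<noteq> \<sigma> (Suc i)" by auto
  have "\<bar>update n v ?g \<sigma> - update n v ?g \<tau>\<bar> \<le> (\<Sum>c<4. L * (if c = e then 11/12 else 1)) / 4"
  proof (rule update_diff_le[of 0 0])
    fix c :: nat assume c: "c < 4"
    let ?s = "recolor n v c \<sigma>" and ?t = "recolor n v (Transposition.transpose 0 0 c) \<tau>"
    have cols: "?s \<in> colorings n 4" "?t \<in> colorings n 4"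
      using col v c by (simp_all add: recolor_coloring)
    have ag': "agree_off {i} ?s ?t" by (rule agree_off_recolor[OF ag nb]) simp
    have "?s (i - 2) \<noteq> ?s (Suc i)" if "c = e"
      using recolor_free[OF e(2,3), of n] e that by (simp add: v_def)
    then show "\<bar>?g ?s - ?g ?t\<bar> \<le> L * (if c = e then 11/12 else 1)"
      using left_neighbor_update[OF _ i(2) cols ag'] i by auto
  qed auto
  also have "(\<Sum>c<(4::nat). L * (if c = e then 11/12 else 1)) = L * (47/12)"
  proof -
    have "(\<Sum>c<(4::nat). if c = e then 11/12 else 1 :: real)
        = (\<Sum>c<4. 1 - (if c = e then 1/12 else 0))"
      by (intro sum.cong) auto
    also have "\<dots> = 47/12" using e(1) by (simp add: sum_subtractf)
    finally show ?thesis by (simp add: sum_distrib_left[symmetric])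
  qed
  finally show ?thesis by (simp add: step)
qed

text \<open>
  The bound for \<open>i - 2\<close> is uniform in the configuration, and identical proposals at earlier
  vertices keep \<open>i\<close> the only disagreement.
\<close>

lemma far_left_updates:
  assumes "v \<le> i - 2" "1 \<le> v" "2 < i" "i \<le> n" "\<sigma> \<in> colorings n 4" "\<tau> \<in> colorings n 4"
    "agree_off {i} \<sigma> \<tau>"
  shows "\<bar>sweep_from n v g \<sigma> - sweep_from n v g \<tau>\<bar> \<le> L * (47/48)"
  using assms
proof (induction v arbitrary: \<sigma> \<tau> rule: inc_induct)
  case base
  then show ?case by (intro second_left_neighbor_update)
next
  case (step v)
  let ?g = "sweep_from n (Suc v) g"
  have v: "v \<in> {1..n}" "v \<le> n" "v - 1 \<notin> {i}" "Suc v \<notin> {i}" using step by auto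
  have nb: "nbrs_swapped n v 0 0 \<sigma> \<tau>"
    by (rule nbrs_swapped_same[OF step.prems(6) v(3,4)])
  have "\<bar>update n v ?g \<sigma> - update n v ?g \<tau>\<bar> \<le> (\<Sum>c<4::nat. L * (47/48)) / 4"
  proof (rule update_diff_le[of 0 0])
    fix c :: nat assume c: "c < 4"
    let ?s = "recolor n v c \<sigma>" and ?t = "recolor n v (Transposition.transpose 0 0 c) \<tau>"
    have cols: "?s \<in> colorings n 4" "?t \<in> colorings n 4"
      using step.prems(4,5) v c by (simp_all add: recolor_coloring)
    have "agree_off {i} ?s ?t" by (rule agree_off_recolor[OF step.prems(6) nb]) simp
    then show "\<bar>?g ?s - ?g ?t\<bar> \<le> L * (47/48)"
      using step.IH[OF _ step.prems(2,3) cols] by simp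
  qed auto
  then show ?case using v by (simp add: sweep_from_step)
qed

lemma sweep_single_disagreement:
  assumes "i \<in> {1..n}" "\<sigma> \<in> colorings n 4" "\<tau> \<in> colorings n 4" "agree_off {i} \<sigma> \<tau>"
  shows "\<bar>sweep_from n 1 g \<sigma> - sweep_from n 1 g \<tau>\<bar> \<le> L * (47/48)"
proof -
  consider "i = 1" | "i = 2" | "2 < i" using assms(1) by fastforce
  then show ?thesis
  proof cases
    case 1
    then have "\<bar>sweep_from n 1 g \<sigma> - sweep_from n 1 g \<tau>\<bar> \<le> L * (2/3)"
      using single_removal(1)[of 1 \<sigma> \<tau>] assms by simp
    then show ?thesis using L by linarith
  next
    case 2
    then have "\<bar>sweep_from n 1 g \<sigma> - sweep_from n 1 g \<tau>\<bar> \<le> L * (11/12)"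
      using left_neighbor_update(2)[of 2 \<sigma> \<tau>] assms by simp
    then show ?thesis using L by linarith
  next
    case 3
    then show ?thesis using far_left_updates[of 1 i \<sigma> \<tau>] assms by simp
  qed
qed

text \<open>
  The path step of path coupling: all colorings, proper or not, are admitted as states, so two
  of them are joined by changing the disagreeing vertices one at a time.
\<close>

theorem sweep_contracts: "hamming_lipschitz n (47/48 * L) (sweep_from n 1 g)"
  unfolding hamming_lipschitz_def
proof (intro allI impI)
  fix D and \<sigma> \<tau> :: "nat \<Rightarrow> nat"
  assume D: "D \<subseteq> {1..n}" and col: "\<sigma> \<in> colorings n 4" "\<tau> \<in> colorings n 4" and "agree_off D \<sigma> \<tau>"
  have "finite D" using D finite_subset by blast
  then show "\<bar>sweep_from n 1 g \<sigma> - sweep_from n 1 g \<tau>\<bar> \<le> 47/48 * L * real (card D)"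
    using D \<open>agree_off D \<sigma> \<tau>\<close> col(1)
  proof (induction D arbitrary: \<sigma>)
    case empty
    then have "\<sigma> = \<tau>" by (auto simp: agree_off_def)
    then show ?case by simp
  next
    case (insert i D)
    let ?\<rho> = "\<sigma>(i := \<tau> i)"
    have i: "i \<in> {1..n}" using insert by auto
    have \<rho>: "?\<rho> \<in> colorings n 4"
      using insert.prems i col(2) by (auto simp: colorings_def PiE_iff extensional_def)
    have "\<bar>sweep_from n 1 g ?\<rho> - sweep_from n 1 g \<tau>\<bar> \<le> 47/48 * L * real (card D)"
      using insert.prems by (intro insert.IH \<rho>) (auto simp: agree_off_def)
    moreover have "\<bar>sweep_from n 1 g \<sigma> - sweep_from n 1 g ?\<rho>\<bar> \<le> L * (47/48)"
      by (rule sweep_single_disagreement[OF i insert.prems(3) \<rho>]) (simp add: agree_off_def)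
    ultimately have "\<bar>sweep_from n 1 g \<sigma> - sweep_from n 1 g \<tau>\<bar>
        \<le> 47/48 * L * real (card D) + L * (47/48)" by linarith
    also have "\<dots> = 47/48 * L * real (card (insert i D))"
      using insert.hyps by (simp add: algebra_simps)
    finally show ?case .
  qed
qed

end

section \<open>From contraction to total variation\<close>

lemma expectation_bind_finite:
  fixes h :: "'b \<Rightarrow> real"
  assumes "finite (set_pmf p)" "\<And>x. x \<in> set_pmf p \<Longrightarrow> finite (set_pmf (f x))"
  shows "measure_pmf.expectation (p \<bind> f) h
    = measure_pmf.expectation p (\<lambda>x. measure_pmf.expectation (f x) h)"
  using pmf_expectation_bind[OF assms subset_refl, where h = h]
    integral_measure_pmf[OF assms(1), of p "\<lambda>x. measure_pmf.expectation (f x) h"] by simp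

lemma expectation_metropolis:
  "measure_pmf.expectation (metropolis n 4 v \<sigma>) g = update n v g \<sigma>"
proof -
  have "{..<4::nat} \<noteq> {}" by (simp add: lessThan_empty_iff)
  then show ?thesis
    by (simp add: metropolis_def integral_pmf_of_set update_def recolor_def)
qed

lemma finite_metropolis: "finite (set_pmf (metropolis n 4 v \<sigma>))"
proof -
  have "{..<4::nat} \<noteq> {}" by (simp add: lessThan_empty_iff)
  then show ?thesis by (simp add: metropolis_def)
qed

lemma expectation_scan_chain:
  "finite (set_pmf (scan_chain n 4 \<sigma>))"
  "measure_pmf.expectation (scan_chain n 4 \<sigma>) g = sweep_from n 1 g \<sigma>"
proof -
  let ?F = "\<lambda>v p. bind_pmf p (metropolis n 4 v)"
  have "finite (set_pmf (fold ?F vs p)) \<and>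
      measure_pmf.expectation (fold ?F vs p) g = measure_pmf.expectation p (sweep n vs g)"
    if "finite (set_pmf p)" for vs p
    using that
  proof (induction vs arbitrary: p)
    case (Cons v vs)
    have "finite (set_pmf (bind_pmf p (metropolis n 4 v)))"
      using Cons.prems finite_metropolis by simp
    moreover have "measure_pmf.expectation (bind_pmf p (metropolis n 4 v)) (sweep n vs g)
        = measure_pmf.expectation p (update n v (sweep n vs g))"
      using expectation_bind_finite[OF Cons.prems finite_metropolis]
      by (simp add: expectation_metropolis)
    ultimately show ?case using Cons.IH by simp
  qed simp
  from this[of "return_pmf \<sigma>" "[1..<Suc n]"]
  show "finite (set_pmf (scan_chain n 4 \<sigma>))"
    "measure_pmf.expectation (scan_chain n 4 \<sigma>) g = sweep_from n 1 g \<sigma>"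
    by (simp_all add: scan_chain_def sweep_from_def del: upt_Suc)
qed

lemma finite_kernel_power:
  "(\<And>x. finite (set_pmf (K x))) \<Longrightarrow> finite (set_pmf (kernel_power K t x))"
  by (induction t) simp_all

lemma set_kernel_power:
  assumes "\<And>x. x \<in> S \<Longrightarrow> set_pmf (K x) \<subseteq> S" "x \<in> S"
  shows "set_pmf (kernel_power K t x) \<subseteq> S"
  using assms by (induction t) fastforce+

lemma bind_kernel_power_stationary:
  "stationary K \<pi> \<Longrightarrow> bind_pmf \<pi> (kernel_power K t) = \<pi>"
proof (induction t)
  case 0
  have "kernel_power K 0 = return_pmf" by (rule ext) simp
  then show ?case by (simp add: bind_return_pmf')
next
  case (Suc t)
  have "kernel_power K (Suc t) = (\<lambda>x. bind_pmf (kernel_power K t x) K)" by (rule ext) simp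
  then have "bind_pmf \<pi> (kernel_power K (Suc t))
      = bind_pmf (bind_pmf \<pi> (kernel_power K t)) K"
    by (simp only: bind_assoc_pmf)
  also have "\<dots> = \<pi>" using Suc by (simp only: stationary_def)
  finally show ?case .
qed

lemma scan_power_contracts:
  assumes "hamming_lipschitz n L g" "0 \<le> L" "\<sigma> \<in> colorings n 4" "\<tau> \<in> colorings n 4"
  shows "\<bar>measure_pmf.expectation (kernel_power (scan_chain n 4) t \<sigma>) g
      - measure_pmf.expectation (kernel_power (scan_chain n 4) t \<tau>) g\<bar> \<le> (47/48) ^ t * L * real n"
  using assms(1,2)
proof (induction t arbitrary: g L)
  case 0
  have "agree_off {1..n} \<sigma> \<tau>"
    using assms(3,4) by (auto simp: agree_off_def colorings_def PiE_iff extensional_def)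
  then show ?case
    using 0(1)[unfolded hamming_lipschitz_def, rule_format, OF subset_refl assms(3,4)] by simp
next
  case (Suc t)
  have "measure_pmf.expectation (kernel_power (scan_chain n 4) (Suc t) \<rho>) g
      = measure_pmf.expectation (kernel_power (scan_chain n 4) t \<rho>) (sweep_from n 1 g)" for \<rho>
    using expectation_bind_finite[OF finite_kernel_power[OF expectation_scan_chain(1)]
        expectation_scan_chain(1), where h = g]
    by (simp add: expectation_scan_chain(2))
  then show ?case
    using Suc.IH[OF sweep_contracts[OF Suc.prems]] Suc.prems(2) by (simp add: algebra_simps)
qed

text \<open>
  Total variation distance is attained by the test function that is \<open>1/2\<close> where \<open>p\<close> exceeds \<open>r\<close> and
  \<open>- 1/2\<close> where it falls short; its oscillation is at most \<open>1\<close>.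
\<close>

lemma tv_dist_witness:
  assumes "finite S" "set_pmf p \<subseteq> S" "set_pmf r \<subseteq> S"
  obtains f :: "'a \<Rightarrow> real" where "\<And>x. \<bar>f x\<bar> \<le> 1/2"
    "tv_dist S p r = measure_pmf.expectation p f - measure_pmf.expectation r f"
proof
  let ?f = "\<lambda>x. sgn (pmf p x - pmf r x) / 2"
  show "\<bar>?f x\<bar> \<le> 1/2" for x by (simp add: sgn_if)
  have "measure_pmf.expectation p ?f - measure_pmf.expectation r ?f
      = (\<Sum>x\<in>S. ?f x * pmf p x - ?f x * pmf r x)"
    using assms by (subst (1 2) integral_measure_pmf_real[OF assms(1)]) (auto simp: sum_subtractf)
  also have "\<dots> = (\<Sum>x\<in>S. \<bar>pmf p x - pmf r x\<bar> / 2)"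
    by (intro sum.cong) (auto simp: sgn_if field_simps)
  finally show "tv_dist S p r = measure_pmf.expectation p ?f - measure_pmf.expectation r ?f"
    by (simp add: tv_dist_def sum_divide_distrib)
qed

lemma expectation_near_constant:
  fixes h :: "'a \<Rightarrow> real"
  assumes fin: "finite (set_pmf p)" and "\<And>x. x \<in> set_pmf p \<Longrightarrow> \<bar>a - h x\<bar> \<le> B"
  shows "\<bar>a - measure_pmf.expectation p h\<bar> \<le> B"
proof -
  let ?S = "set_pmf p"
  have one: "(\<Sum>x\<in>?S. pmf p x) = 1" using fin by (intro sum_pmf_eq_1) auto
  have "measure_pmf.expectation p h = (\<Sum>x\<in>?S. h x * pmf p x)"
    by (rule integral_measure_pmf_real[OF fin])
  then have "a - measure_pmf.expectation p h = (\<Sum>x\<in>?S. (a - h x) * pmf p x)"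
    using one by (simp add: left_diff_distrib sum_subtractf flip: sum_distrib_left)
  also have "\<bar>\<dots>\<bar> \<le> (\<Sum>x\<in>?S. B * pmf p x)"
    by (rule order_trans[OF sum_abs])
      (use assms(2) in \<open>auto simp: abs_mult intro!: sum_mono mult_right_mono\<close>)
  also have "\<dots> = B" using one by (simp flip: sum_distrib_left)
  finally show ?thesis .
qed

text \<open>
  By stationarity the uniform distribution is a mixture of the laws after \<open>t\<close> scans from its own
  support, and each of those is close to the law after \<open>t\<close> scans from \<open>\<sigma>\<close>.
\<close>

lemma tv_dist_scan_power:
  assumes \<sigma>: "\<sigma> \<in> colorings n 4"
  shows "tv_dist (colorings n 4) (kernel_power (scan_chain n 4) t \<sigma>) (uniform_proper n 4)
    \<le> (47/48) ^ t * real n"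
proof -
  let ?K = "kernel_power (scan_chain n 4) t" and ?\<pi> = "uniform_proper n 4"
  have "proper_colorings n 4 \<noteq> {}" by (rule proper_colorings_nonempty) simp
  then have set\<pi>: "set_pmf ?\<pi> \<subseteq> colorings n 4"
    using finite_proper_colorings[of n 4] by (auto simp: uniform_proper_def proper_colorings_def)
  then have fin\<pi>: "finite (set_pmf ?\<pi>)" using finite_colorings finite_subset by blast
  have "set_pmf (?K \<sigma>) \<subseteq> colorings n 4"
    by (rule set_kernel_power[OF scan_chain_colorings \<sigma>]) auto
  then obtain f where f: "\<And>x. \<bar>f x\<bar> \<le> 1/2" and tv: "tv_dist (colorings n 4) (?K \<sigma>) ?\<pi>
      = measure_pmf.expectation (?K \<sigma>) f - measure_pmf.expectation ?\<pi> f"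
    using tv_dist_witness[OF finite_colorings _ set\<pi>] by blast
  have "hamming_lipschitz n 1 f"
    unfolding hamming_lipschitz_def
  proof (intro allI impI)
    fix D and \<sigma> \<tau> :: "nat \<Rightarrow> nat"
    assume D: "D \<subseteq> {1..n}" and ag: "agree_off D \<sigma> \<tau>"
    have "finite D" using D finite_subset by blast
    show "\<bar>f \<sigma> - f \<tau>\<bar> \<le> 1 * real (card D)"
    proof (cases "D = {}")
      case True
      then have "\<sigma> = \<tau>" using ag by (auto simp: agree_off_def)
      then show ?thesis by simp
    next
      case False
      then have "1 \<le> real (card D)" using \<open>finite D\<close> by (simp add: Suc_le_eq card_gt_0_iff)
      then show ?thesis using f[of \<sigma>] f[of \<tau>] by linarith
    qed
  qed
  from scan_power_contracts[OF this _ \<sigma>]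
  have close: "\<bar>measure_pmf.expectation (?K \<sigma>) f - measure_pmf.expectation (?K \<tau>) f\<bar>
      \<le> (47/48) ^ t * real n" if "\<tau> \<in> set_pmf ?\<pi>" for \<tau>
    using that set\<pi> by auto
  have "measure_pmf.expectation ?\<pi> f = measure_pmf.expectation (bind_pmf ?\<pi> ?K) f"
    using bind_kernel_power_stationary[OF scan_chain_stationary, of 4 n t] by simp
  also have "\<dots> = measure_pmf.expectation ?\<pi> (\<lambda>\<tau>. measure_pmf.expectation (?K \<tau>) f)"
    by (rule expectation_bind_finite[OF fin\<pi> finite_kernel_power[OF expectation_scan_chain(1)]])
  moreover have "\<bar>measure_pmf.expectation (?K \<sigma>) f
      - measure_pmf.expectation ?\<pi> (\<lambda>\<tau>. measure_pmf.expectation (?K \<tau>) f)\<bar> \<le> (47/48) ^ t * real n"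
    by (rule expectation_near_constant[OF fin\<pi> close])
  ultimately show ?thesis using tv by linarith
qed

lemma mix_time_le:
  assumes "0 < t" "\<And>x. x \<in> S \<Longrightarrow> tv_dist S (kernel_power K t x) \<pi> \<le> \<epsilon>"
  shows "mix_time S K \<pi> \<epsilon> \<le> enat t"
  unfolding mix_time_def mix_time_from_def
  using assms by (intro SUP_least INF_lower) auto

theorem theorem22:
  fixes n :: nat and \<epsilon> :: real
  assumes "n > 3" and "0 < \<epsilon>" and "\<epsilon> < 1"
  shows "ereal_of_enat (mix_time (colorings n 4) (scan_chain n 4) (uniform_proper n 4) \<epsilon>)
           \<le> ereal (192 * ln (real n * inverse \<epsilon>))"
proof -
  define l where "l = ln (real n * inverse \<epsilon>)"
  define t where "t = nat \<lfloor>192 * l\<rfloor>"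
  have "exp 1 \<le> (3::real)" by (rule exp_le)
  also have "\<dots> \<le> real n * 1" using assms by simp
  also have "\<dots> \<le> real n * inverse \<epsilon>"
    using assms by (intro mult_left_mono) (auto simp: one_le_inverse_iff)
  finally have l: "1 \<le> l"
    unfolding l_def using assms by (subst ln_ge_iff) auto
  have t: "192 * l - 1 \<le> real t" "real t \<le> 192 * l" "0 < t"
    using l by (auto simp: t_def)
  \<comment> \<open>Rounding down costs at most one scan. The rate \<open>1/48\<close> leaves room for it, as
    \<open>t \<ge> 192 l - 1 \<ge> 48 l\<close>.\<close>
  have "(47/48::real) ^ t \<le> exp (- (1/48)) ^ t"
    using exp_ge_add_one_self[of "- (1/48)"] by (intro power_mono) auto
  also have "\<dots> = exp (- (real t / 48))" by (simp flip: exp_of_nat_mult)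
  also have "\<dots> \<le> exp (- l)" using t l by simp
  also have "\<dots> = \<epsilon> / real n"
    using assms by (simp add: l_def exp_minus divide_inverse mult.commute)
  finally have "(47/48) ^ t * real n \<le> \<epsilon>"
    using assms by (simp add: field_simps)
  then have "mix_time (colorings n 4) (scan_chain n 4) (uniform_proper n 4) \<epsilon> \<le> enat t"
    using tv_dist_scan_power[of _ n t] t(3) by (intro mix_time_le) force+
  then have "ereal_of_enat (mix_time (colorings n 4) (scan_chain n 4) (uniform_proper n 4) \<epsilon>)
      \<le> ereal_of_enat (enat t)"
    by (simp only: ereal_of_enat_le_iff)
  also have "\<dots> \<le> ereal (192 * l)" using t(2) by simp
  finally show ?thesis by (simp only: l_def)
qed

end
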